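(* Let $\mu>-\tfrac32$ and $-\tfrac12<\nu<\mu+1$ be real. Then, for all $x>0$, $$\tilde t_{\mu+1,\nu+1}(x)<\frac{x^{\mu+2}}{2^{\mu+1}(\mu+\nu+2)\,\Gamma\big(\frac{\mu-\nu+3}{2}\big)\Gamma\big(\frac{\mu+\nu+3}{2}\big)}\;{}_2F_3\bigg(1,\frac{\mu+\nu+2}{2};\frac{\mu-\nu+3}{2},\frac{\mu+\nu+3}{2},\frac{\mu+\nu+4}{2};\frac{x^2}{4}\bigg)$$ and $$\frac{x^{\mu+2}}{2^{\mu+1}(\mu+\nu+2)\,\Gamma\big(\frac{\mu-\nu+3}{2}\big)\Gamma\big(\frac{\mu+\nu+3}{2}\big)}\;{}_2F_3\bigg(1,\frac{\mu+\nu+2}{2};\frac{\mu-\nu+3}{2},\frac{\mu+\nu+3}{2},\frac{\mu+\nu+4}{2};\frac{x^2}{4}\bigg)<\tilde t_{\mu+1,\nu+1}(x)\bigg\{1+\frac{1}{2\nu+1}\bigg(1-\frac{\tilde t_{\mu+3,\nu+3}(x)}{\tilde t_{\mu+1,\nu+1}(x)}\bigg)\bigg\}-a_{\mu,\nu,0}\,x^{\mu+2}.$$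
   Context: For real $\mu,\nu$ and $x>0$, the (normalized) modified Lommel function of the first kind is $$\tilde t_{\mu,\nu}(x)=\sum_{k=0}^\infty\frac{(\tfrac12x)^{\mu+2k+1}}{\Gamma\big(k+\frac{\mu-\nu+3}{2}\big)\Gamma\big(k+\frac{\mu+\nu+3}{2}\big)}.$$ The constant is $$a_{\mu,\nu,0}=\frac{1}{2^{\mu+1}(2\nu+1)(\mu+\nu+2)\,\Gamma\big(\frac{\mu-\nu+1}{2}\big)\Gamma\big(\frac{\mu+\nu+5}{2}\big)}.$$ ${}_2F_3(a_1,a_2;b_1,b_2,b_3;z)=\sum_{k=0}^\infty\frac{(a_1)_k(a_2)_k}{(b_1)_k(b_2)_k(b_3)_k}\frac{z^k}{k!}$ is the generalized hypergeometric function, where $(a)_k=a(a+1)\cdots(a+k-1)$, $(a)_0=1$. *)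

theory Defs
  imports "HOL-Analysis.Analysis"
begin

(* At a pole of Gamma the library has Gamma = 0, so the corresponding quotient is 0,
   which agrees with the usual reading 1 / Gamma = 0 there. *)
definition lommel_t :: "real \<Rightarrow> real \<Rightarrow> real \<Rightarrow> real" where
  "lommel_t \<mu> \<nu> x =
    (\<Sum>k. (x / 2) powr (\<mu> + 2 * real k + 1) /
      (Gamma (real k + (\<mu> - \<nu> + 3) / 2) * Gamma (real k + (\<mu> + \<nu> + 3) / 2)))"

definition hypergeom_2F3 :: "real \<Rightarrow> real \<Rightarrow> real \<Rightarrow> real \<Rightarrow> real \<Rightarrow> real \<Rightarrow> real" where
  "hypergeom_2F3 a1 a2 b1 b2 b3 z =
    (\<Sum>k. (pochhammer a1 k * pochhammer a2 k) /
      (pochhammer b1 k * pochhammer b2 k * pochhammer b3 k) * (z ^ k / fact k))"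

definition lommel_a0 :: "real \<Rightarrow> real \<Rightarrow> real" where
  "lommel_a0 \<mu> \<nu> =
    1 / (2 powr (\<mu> + 1) * (2 * \<nu> + 1) * (\<mu> + \<nu> + 2) *
      Gamma ((\<mu> - \<nu> + 1) / 2) * Gamma ((\<mu> + \<nu> + 5) / 2))"

end

theory Submission
  imports Defs
begin

text \<open>
  Let \<open>u k\<close> be the terms of the series of \<open>t\<close> with parameters \<open>\<mu> + 1\<close>, \<open>\<nu> + 1\<close>, and put
  \<open>a = (\<mu> - \<nu> + 3) / 2\<close>, \<open>b = (\<mu> + \<nu> + 3) / 2\<close>. The hypergeometric expression has the terms
  \<open>u k * (k + b) / (k + b - 1/2)\<close>, which gives the lower bound. For \<open>k \<ge> 1\<close>, the \<open>(k - 1)\<close>-st term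
  of \<open>t\<close> with parameters \<open>\<mu> + 3\<close>, \<open>\<nu> + 3\<close> is \<open>u k * (k + a - 1) / (k + b + 1)\<close>. In the upper bound
  the terms with \<open>k = 0\<close> of the two sides agree because of \<open>a\<^sub>0\<close>, and for \<open>k \<ge> 1\<close> their difference
  is \<open>u k\<close> times \<open>3 (k + a - 1) / (2 (2\<nu> + 1) (k + b + 1) (k + b - 1/2)) > 0\<close>.
\<close>

lemma sums_pos: "s > 0" if "f sums s" "\<And>n. f n > 0" for f :: "nat \<Rightarrow> real"
  using suminf_pos[of f] that by (simp add: sums_iff)

lemma Gamma_real_plus1: "Gamma (y + 1) = y * Gamma y" if "y > 0" for y :: real
  using that by (intro Gamma_plus1) (auto elim!: nonpos_Ints_cases)

text \<open>The ratio of consecutive terms is \<open>z / ((k + a) * (k + b))\<close>. Once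
  \<open>k\<close> is at least 1 and at least \<open>2 * \<bar>z\<bar>\<close>, the denominator is
  at least \<open>k * k \<ge> 2 * \<bar>z\<bar>\<close>, so the ratio test applies with constant
  1/2.\<close>

lemma summable_power_over_Gammas:
  fixes a b z :: real
  assumes "a > 0" "b > 0"
  shows "summable (\<lambda>k. z ^ k / (Gamma (real k + a) * Gamma (real k + b)))"
proof (rule summable_ratio_test)
  fix k :: nat
  assume k: "k \<ge> nat \<lceil>2 * \<bar>z\<bar>\<rceil> + 1"
  then have "2 * \<bar>z\<bar> \<le> real k" "1 \<le> real k"
    by linarith+
  then have "2 * \<bar>z\<bar> \<le> real k * real k"
    using mult_left_mono[of 1 "real k" "real k"] by linarith
  also have "\<dots> \<le> (real k + a) * (real k + b)"
    using assms by (intro mult_mono) auto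
  finally have z: "2 * \<bar>z\<bar> \<le> (real k + a) * (real k + b)" .
  have pos: "Gamma (real k + a) > 0" "Gamma (real k + b) > 0"
    "real k + a > 0" "real k + b > 0"
    using assms by (auto intro!: Gamma_real_pos add_nonneg_pos)
  have step: "Gamma (real (Suc k) + a) = (real k + a) * Gamma (real k + a)"
    "Gamma (real (Suc k) + b) = (real k + b) * Gamma (real k + b)"
    using Gamma_real_plus1[OF pos(3)] Gamma_real_plus1[OF pos(4)] by (simp_all add: algebra_simps)
  have "\<bar>z\<bar> / ((real k + a) * (real k + b)) \<le> 1 / 2"
    using z pos by (simp add: divide_simps)
  then have "\<bar>z\<bar> / ((real k + a) * (real k + b)) *
      (\<bar>z\<bar> ^ k / (Gamma (real k + a) * Gamma (real k + b)))
    \<le> 1 / 2 * (\<bar>z\<bar> ^ k / (Gamma (real k + a) * Gamma (real k + b)))"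
    using pos by (intro mult_right_mono) auto
  then show "norm (z ^ Suc k / (Gamma (real (Suc k) + a) * Gamma (real (Suc k) + b)))
    \<le> 1 / 2 * norm (z ^ k / (Gamma (real k + a) * Gamma (real k + b)))"
    unfolding step using pos by (simp add: abs_mult power_abs mult_ac)
qed simp

text \<open>Pulling out the power that does not depend on \<open>k\<close> leaves a power series in
  \<open>x\<^sup>2 / 4\<close>. The two sign conditions keep every Gamma argument positive, hence
  away from the poles.\<close>

lemma lommel_t_sums:
  fixes \<mu> \<nu> x :: real
  assumes "x > 0" "\<mu> - \<nu> + 3 > 0" "\<mu> + \<nu> + 3 > 0"
  shows "(\<lambda>k. (x / 2) powr (\<mu> + 1) * ((x\<^sup>2 / 4) ^ k /
      (Gamma (real k + (\<mu> - \<nu> + 3) / 2) * Gamma (real k + (\<mu> + \<nu> + 3) / 2)))) sums lommel_t \<mu> \<nu> x"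
proof -
  have "(x / 2) powr (\<mu> + 2 * real k + 1) = (x / 2) powr (\<mu> + 1) * (x\<^sup>2 / 4) ^ k" for k
  proof -
    have "(x / 2) powr (\<mu> + 2 * real k + 1) = (x / 2) powr ((\<mu> + 1) + real (2 * k))"
      by (simp add: algebra_simps)
    also have "\<dots> = (x / 2) powr (\<mu> + 1) * (x / 2) ^ (2 * k)"
      using assms(1) by (subst powr_add, subst powr_realpow) auto
    also have "(x / 2) ^ (2 * k) = (x\<^sup>2 / 4) ^ k"
      by (simp add: power_mult power_divide)
    finally show ?thesis .
  qed
  then have "lommel_t \<mu> \<nu> x = (\<Sum>k. (x / 2) powr (\<mu> + 1) * ((x\<^sup>2 / 4) ^ k /
      (Gamma (real k + (\<mu> - \<nu> + 3) / 2) * Gamma (real k + (\<mu> + \<nu> + 3) / 2))))"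
    by (simp add: lommel_t_def)
  moreover have "summable (\<lambda>k. (x / 2) powr (\<mu> + 1) * ((x\<^sup>2 / 4) ^ k /
      (Gamma (real k + (\<mu> - \<nu> + 3) / 2) * Gamma (real k + (\<mu> + \<nu> + 3) / 2))))"
    using assms by (intro summable_mult summable_power_over_Gammas) auto
  ultimately show ?thesis
    by (simp add: summable_sums)
qed

lemma Gamma_real_add_nat: "Gamma (real k + y) = pochhammer y k * Gamma y" if "y > 0" for y :: real
proof -
  have "y \<notin> \<int>\<^sub>\<le>\<^sub>0"
    using that by (auto elim!: nonpos_Ints_cases)
  then show ?thesis
    using pochhammer_Gamma[of y k] Gamma_real_pos[OF that] by (simp add: add.commute)
qed

text \<open>Both \<open>pochhammer y k * (y + k)\<close> and \<open>y * pochhammer (y + 1) k\<close>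
  equal \<open>pochhammer y (Suc k)\<close>. This collapses the two hypergeometric parameters that
  differ by 1.\<close>

lemma pochhammer_ratio_plus1:
  "pochhammer y k / pochhammer (y + 1) k = y / (real k + y)" if "y > 0" for y :: real
proof -
  have "pochhammer (y + 1) k > 0"
    using that by (intro pochhammer_pos) auto
  moreover have "pochhammer y k * (y + real k) = y * pochhammer (y + 1) k"
    by (metis pochhammer_Suc pochhammer_rec)
  ultimately show ?thesis
    using that by (simp add: field_simps)
qed

theorem corollary2p3:
  fixes \<mu> \<nu> x :: real
  assumes "\<mu> > - (3 / 2)" and "- (1 / 2) < \<nu>" and "\<nu> < \<mu> + 1" and "x > 0"
  shows "lommel_t (\<mu> + 1) (\<nu> + 1) x
      < x powr (\<mu> + 2) /
          (2 powr (\<mu> + 1) * (\<mu> + \<nu> + 2) * Gamma ((\<mu> - \<nu> + 3) / 2) * Gamma ((\<mu> + \<nu> + 3) / 2)) *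
        hypergeom_2F3 1 ((\<mu> + \<nu> + 2) / 2)
          ((\<mu> - \<nu> + 3) / 2) ((\<mu> + \<nu> + 3) / 2) ((\<mu> + \<nu> + 4) / 2) (x\<^sup>2 / 4)
    \<and> x powr (\<mu> + 2) /
          (2 powr (\<mu> + 1) * (\<mu> + \<nu> + 2) * Gamma ((\<mu> - \<nu> + 3) / 2) * Gamma ((\<mu> + \<nu> + 3) / 2)) *
        hypergeom_2F3 1 ((\<mu> + \<nu> + 2) / 2)
          ((\<mu> - \<nu> + 3) / 2) ((\<mu> + \<nu> + 3) / 2) ((\<mu> + \<nu> + 4) / 2) (x\<^sup>2 / 4)
      < lommel_t (\<mu> + 1) (\<nu> + 1) x *
          (1 + 1 / (2 * \<nu> + 1) *
            (1 - lommel_t (\<mu> + 3) (\<nu> + 3) x / lommel_t (\<mu> + 1) (\<nu> + 1) x))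
        - lommel_a0 \<mu> \<nu> * x powr (\<mu> + 2)"
proof -
  define a b z c where "a = (\<mu> - \<nu> + 3) / 2" and "b = (\<mu> + \<nu> + 3) / 2"
    and "z = x\<^sup>2 / 4" and "c = (x / 2) powr (\<mu> + 2)"
  \<comment> \<open>\<open>a > 1\<close> is \<nu> < \<mu> + 1, and \<open>b > 1 / 2\<close> is \<mu>
    + \<nu> + 2 > 0, the sum of the two lower bounds.\<close>
  have a: "a > 1" and b: "b > 1 / 2" and z: "z > 0" and c: "c > 0" and \<nu>: "2 * \<nu> + 1 > 0" "\<nu> = b - a"
    using assms by (auto simp: a_def b_def z_def c_def field_simps)
  have Ga: "Gamma (real k + a) > 0" and Gb: "Gamma (real k + b) > 0" for k
    using a b by (auto intro!: Gamma_real_pos add_nonneg_pos)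
  have Gb1: "Gamma (real k + (b + 1)) = (real k + b) * Gamma (real k + b)" for k
    using Gamma_real_plus1[of "real k + b"] b by (simp add: add.assoc)
  define u where "u k = c * (z ^ k / (Gamma (real k + a) * Gamma (real k + (b + 1))))" for k
  define T T' where "T = lommel_t (\<mu> + 1) (\<nu> + 1) x" and "T' = lommel_t (\<mu> + 3) (\<nu> + 3) x"
  have kb: "real k + b > 1 / 2" for k
    using b by (simp add: add_strict_increasing2)
  have u_pos: "u k > 0" for k
    unfolding u_def Gb1 using Ga[of k] Gb[of k] kb[of k] z c by simp
  have T: "u sums T"
  proof -
    have params: "(\<mu> + 1 - (\<nu> + 1) + 3) / 2 = a" "(\<mu> + 1 + (\<nu> + 1) + 3) / 2 = b + 1" "\<mu> + 1 + 1 = \<mu> + 2"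
      by (simp_all add: a_def b_def field_simps)
    show ?thesis
      unfolding u_def T_def c_def z_def
      using assms by (intro lommel_t_sums[of x "\<mu> + 1" "\<nu> + 1", unfolded params]) auto
  qed
  have T_pos: "T > 0"
    using T u_pos by (rule sums_pos)
  \<comment> \<open>The extra power of \<open>x / 2\<close> supplies one more factor
    \<open>z\<close>, so the \<open>k\<close>-th term is matched with \<open>u (Suc k)\<close>. The
    first Gamma argument then drops by 1 and the second rises by 1, which gives the
    quotient.\<close>
  have T': "(\<lambda>k. u (Suc k) * ((real k + a) / (real k + b + 2))) sums T'"
  proof -
    have params: "(\<mu> + 3 - (\<nu> + 3) + 3) / 2 = a" "(\<mu> + 3 + (\<nu> + 3) + 3) / 2 = b + 3"
      by (simp_all add: a_def b_def field_simps)
    have *: "(\<lambda>k. (x / 2) powr (\<mu> + 3 + 1) * (z ^ k / (Gamma (real k + a) * Gamma (real k + (b + 3)))))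
        sums T'"
      unfolding T'_def z_def
      using assms by (intro lommel_t_sums[of x "\<mu> + 3" "\<nu> + 3", unfolded params]) auto
    have "(x / 2) powr (\<mu> + 3 + 1) = (x / 2) powr (\<mu> + 2 + real 2)"
      by (simp add: algebra_simps)
    also have "\<dots> = c * (x / 2) ^ 2"
      using assms(4) unfolding c_def by (subst powr_add, subst powr_realpow) auto
    finally have cz: "(x / 2) powr (\<mu> + 3 + 1) = c * z"
      by (simp add: z_def power_divide)
    have "(x / 2) powr (\<mu> + 3 + 1) * (z ^ k / (Gamma (real k + a) * Gamma (real k + (b + 3))))
        = u (Suc k) * ((real k + a) / (real k + b + 2))" for k
    proof -
      have "Gamma (real (Suc k) + a) = (real k + a) * Gamma (real k + a)"
        using Gamma_real_plus1[of "real k + a"] a by (simp add: algebra_simps)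
      moreover have "Gamma (real k + (b + 3)) = (real k + b + 2) * Gamma (real (Suc k) + (b + 1))"
        using Gamma_real_plus1[of "real k + b + 2"] b by (simp add: algebra_simps)
      moreover have "Gamma (real (Suc k) + (b + 1)) > 0"
        using b by (intro Gamma_real_pos) auto
      moreover have "real k + a > 0" "real k + b + 2 > 0"
        using a b by (auto intro: add_nonneg_pos)
      ultimately show ?thesis
        unfolding cz u_def using Ga[of k] by (simp add: divide_simps)
    qed
    with * show ?thesis
      by simp
  qed
  define v where "v k = u k * ((real k + b) / (real k + b - 1 / 2))" for k
  define H where "H = x powr (\<mu> + 2) /
          (2 powr (\<mu> + 1) * (\<mu> + \<nu> + 2) * Gamma ((\<mu> - \<nu> + 3) / 2) * Gamma ((\<mu> + \<nu> + 3) / 2)) *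
        hypergeom_2F3 1 ((\<mu> + \<nu> + 2) / 2)
          ((\<mu> - \<nu> + 3) / 2) ((\<mu> + \<nu> + 3) / 2) ((\<mu> + \<nu> + 4) / 2) (x\<^sup>2 / 4)"
  \<comment> \<open>The additional factor 2 is absorbed later by \<mu> + \<nu> + 2 =
    \<open>2 * (b - 1 / 2)\<close>.\<close>
  have c_eq: "c = x powr (\<mu> + 2) / (2 * 2 powr (\<mu> + 1))"
    using assms(4) powr_add[of 2 "\<mu> + 1" 1] by (simp add: c_def powr_divide add_ac)
  \<comment> \<open>The factor \<open>(k + b) / (k + b - 1 / 2)\<close> decreases in
    \<open>k\<close>, so its value at 0 bounds it and \<open>v\<close> converges by comparison with
    \<open>u\<close>.\<close>
  have "v k \<le> u k * (b / (b - 1 / 2))" for k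
    unfolding v_def using b u_pos[of k] kb[of k]
    by (intro mult_left_mono) (auto simp: divide_simps algebra_simps)
  moreover have v_gt: "v k > u k" for k
    using u_pos[of k] kb[of k] by (simp add: v_def divide_simps)
  ultimately have "summable v"
    using T u_pos
    by (intro summable_comparison_test'[of "\<lambda>k. u k * (b / (b - 1 / 2))" 0 v] summable_mult2)
      (auto simp: sums_summable less_imp_le less_trans[OF u_pos v_gt])
  moreover have "H = suminf v"
  proof -
    have params: "(\<mu> + \<nu> + 2) / 2 = b - 1 / 2" "(\<mu> + \<nu> + 4) / 2 = (b - 1 / 2) + 1"
      "\<mu> + \<nu> + 2 = 2 * (b - 1 / 2)"
      by (simp_all add: b_def field_simps)
    define h where "h k = (pochhammer 1 k * pochhammer (b - 1 / 2) k) /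
      (pochhammer a k * pochhammer b k * pochhammer (b - 1 / 2 + 1) k) * (z ^ k / fact k)" for k
    \<comment> \<open>\<open>pochhammer 1 k\<close> cancels \<open>fact k\<close>. The factor
      \<open>k + b\<close> in \<open>v\<close> turns the Gamma value at \<open>k + b + 1\<close> in
      \<open>u\<close> into the one at \<open>k + b\<close>.\<close>
    have h_eq: "c / ((b - 1 / 2) * Gamma a * Gamma b) * h k = v k" for k
    proof -
      have "h k = pochhammer (b - 1 / 2) k / pochhammer (b - 1 / 2 + 1) k * (z ^ k / (pochhammer a k * pochhammer b k))"
        by (simp add: h_def pochhammer_fact[symmetric])
      also have "\<dots> = (b - 1 / 2) / (real k + b - 1 / 2) * (z ^ k / (pochhammer a k * pochhammer b k))"
        using b by (subst pochhammer_ratio_plus1) (auto simp: algebra_simps)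
      finally have "h k = (b - 1 / 2) / (real k + b - 1 / 2) * (z ^ k / (pochhammer a k * pochhammer b k))" .
      moreover have "Gamma (real k + a) = pochhammer a k * Gamma a" "Gamma (real k + b) = pochhammer b k * Gamma b"
        using a b by (simp_all add: Gamma_real_add_nat)
      moreover have "b - 1 / 2 \<noteq> 0" "real k + b \<noteq> 0"
        using b kb[of k] by auto
      ultimately show ?thesis
        unfolding v_def u_def Gb1 by (simp add: mult_ac)
    qed
    \<comment> \<open>Moving the constant through the infinite sum requires convergence of
      \<open>h\<close>. It is inherited from \<open>v\<close>, because the constant is
      nonzero.\<close>
    have "summable h"
    proof -
      have "c / ((b - 1 / 2) * Gamma a * Gamma b) \<noteq> 0"
        using c b Ga[of 0] Gb[of 0, THEN less_imp_neq] by simp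
      moreover have "summable (\<lambda>k. c / ((b - 1 / 2) * Gamma a * Gamma b) * h k)"
        unfolding h_eq by (simp add: \<open>summable v\<close>)
      ultimately show ?thesis
        using summable_cmult_iff by blast
    qed
    moreover have "H = c / ((b - 1 / 2) * Gamma a * Gamma b) * suminf h"
      unfolding H_def hypergeom_2F3_def params(1,2) h_def c_eq unfolding params(3)
      by (simp add: a_def[symmetric] b_def[symmetric] z_def[symmetric] mult_ac)
    ultimately show ?thesis
      by (simp only: suminf_mult[symmetric] h_eq)
  qed
  ultimately have H: "v sums H"
    by (simp add: summable_sums)

  have lower: "T < H"
  proof -
    have "(\<lambda>k. v k - u k) sums (H - T)"
      by (rule sums_diff[OF H T])
    moreover have "v k - u k > 0" for k
      using v_gt[of k] by simp
    ultimately have "H - T > 0"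
      by (rule sums_pos)
    then show ?thesis
      by simp
  qed

  define A where "A = u 0 * ((a - 1) / ((2 * \<nu> + 1) * (b - 1 / 2)))"
  have A: "lommel_a0 \<mu> \<nu> * x powr (\<mu> + 2) = A"
  proof -
    have params: "(\<mu> - \<nu> + 1) / 2 = a - 1" "(\<mu> + \<nu> + 5) / 2 = b + 1" "\<mu> + \<nu> + 2 = 2 * (b - 1 / 2)"
      by (simp_all add: a_def b_def field_simps)
    \<comment> \<open>This recurrence is the source of the factor \<open>a - 1\<close> in
      \<open>A\<close>.\<close>
    have "Gamma a = (a - 1) * Gamma (a - 1)"
      using Gamma_real_plus1[of "a - 1"] a by simp
    moreover have "a - 1 \<noteq> 0"
      using a by simp
    ultimately show ?thesis
      unfolding lommel_a0_def params A_def u_def c_eq by (simp add: mult_ac)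
  qed
  have upper: "H < T + (T - T') / (2 * \<nu> + 1) - A"
  proof -
    \<comment> \<open>The series for \<open>T'\<close> is aligned with \<open>u\<close> from index 1
      on, so the terms of index 0 are split off from \<open>T\<close> and \<open>H\<close>.\<close>
    have tail: "(\<lambda>k. w (Suc k)) sums (s - w 0)" if "w sums s" for w :: "nat \<Rightarrow> real" and s
      using that by (simp add: sums_Suc_iff)
    let ?d = "\<lambda>k. u (Suc k) + (u (Suc k) - u (Suc k) * ((real k + a) / (real k + b + 2))) / (2 * \<nu> + 1)
      - v (Suc k)"
    have d_sums: "?d sums (T - u 0 + (T - u 0 - T') / (2 * \<nu> + 1) - (H - v 0))"
      by (intro sums_add sums_diff sums_divide tail T T' H)
    have d_pos: "?d k > 0" for k
    proof -
      have "?d k = u (Suc k) * (1 + (1 - (real k + a) / (real k + b + 2)) / (2 * \<nu> + 1)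
          - (real k + 1 + b) / (real k + b + 1 / 2))"
        by (simp add: v_def algebra_simps diff_divide_distrib)
      \<comment> \<open>With \<open>n = k + b\<close> and \<nu> = \<open>b - a\<close>, the
        numerator over the common denominator is
        \<open>2 * (\<nu> + 2) * (n + 1 / 2) - (2 * \<nu> + 1) * (n + 2)\<close>, which is
        \<open>3 * (n - \<nu>) = 3 * (k + a)\<close>.\<close>
      also have "1 + (1 - (real k + a) / (real k + b + 2)) / (2 * \<nu> + 1)
          - (real k + 1 + b) / (real k + b + 1 / 2)
        = 3 * (real k + a) / (2 * (2 * \<nu> + 1) * (real k + b + 2) * (real k + b + 1 / 2))"
      proof -
        have "2 * \<nu> + 1 \<noteq> 0" "real k + b + 2 \<noteq> 0" "real k + b + 1 / 2 \<noteq> 0"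
          using \<nu>(1) kb[of k] by linarith+
        then show ?thesis
          unfolding \<nu>(2) by (simp add: divide_simps) (simp add: algebra_simps)
      qed
      also have "u (Suc k) * \<dots> > 0"
        using u_pos[of "Suc k"] a kb[of k] \<nu>(1)
        by (intro mult_pos_pos divide_pos_pos) (auto intro!: add_nonneg_pos)
      finally show ?thesis .
    qed
    have "0 < T - u 0 + (T - u 0 - T') / (2 * \<nu> + 1) - (H - v 0)"
      using d_sums d_pos by (rule sums_pos)
    moreover have "u 0 + u 0 / (2 * \<nu> + 1) - v 0 = A"
    proof -
      have "2 * \<nu> + 1 \<noteq> 0" "b - 1 / 2 \<noteq> 0"
        using \<nu>(1) b by linarith+
      then show ?thesis
        unfolding A_def v_def \<nu>(2) by (simp add: divide_simps) (simp add: algebra_simps)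
    qed
    ultimately show ?thesis
      by (simp add: diff_divide_distrib)
  qed
  \<comment> \<open>Since \<open>T\<close> is positive, the quotient cancels and the bound becomes
    linear in \<open>T\<close> and \<open>T'\<close>.\<close>
  have "T * (1 - T' / T) = T - T'"
    using T_pos by (simp add: right_diff_distrib)
  then have "T * (1 + 1 / (2 * \<nu> + 1) * (1 - T' / T)) = T + (T - T') / (2 * \<nu> + 1)"
    by (simp add: distrib_left)
  with lower upper show ?thesis
    unfolding H_def[symmetric] A T_def[symmetric] T'_def[symmetric] by simp
qed

end
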